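(* Let $k\ge 2$ and consider a multi-objective integer optimization problem with $k$ objectives and finite nondominated set $Y_N\subseteq\mathbb{R}^k$. The algorithm PEA (described in the context) terminates and its output is the entire nondominated set $Y_N$. Moreover, the number of lexicographic epsilon-constraint scalarization problems it solves (i.e. the number of calls to the solver) is in $\mathcal{O}(|Y_N|^{\lfloor k/2\rfloor})$; that is, for each fixed $k$ there is a constant $C_k$ such that for every such problem with $Y_N\neq\emptyset$ the number of solved scalarization problems is at most $C_k\,|Y_N|^{\lfloor k/2\rfloor}$.
   Context: Problem: $\min f(x)=(f_1(x),\dots,f_k(x))$ subject to $x\in X\subseteq\mathbb{Z}^n$; $Y=f(X)\subseteq\mathbb{R}^k$. For vectors $a,b$ of equal length: $a\leq b$ means $a_i\le b_i$ for all $i$ and $a\ne b$; $a<b$ means $a_i<b_i$ for all $i$. The nondominated set is $Y_N=\{y\in Y:\text{ there is no }\bar y\in Y\text{ with }\bar y\leq y\}$, assumed finite. Notation: $[m]=\{1,\dots,m\}$; for $y\in\mathbb{R}^k$, $y_{-k}=(y_1,\dots,y_{k-1})$ and $y_{-[i]}=(y_{i+1},\dots,y_k)$. Scalarization: for $\varepsilon\in(\mathbb{R}\cup\{\infty\})^{k-1}$, $\Pi(\varepsilon)$ is the problem of lexicographically minimizing $(f_k(x),f_{k-1}(x),\dots,f_1(x))$ subject to $f_{-k}(x)<\varepsilon$, $x\in X$. An image $y\in Y_N$ is feasible for $\Pi(\varepsilon)$ if $y_{-k}<\varepsilon$; the (unique) optimal image of $\Pi(\varepsilon)$ is the feasible $y\in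 Y_N$ for which $(y_k,\dots,y_1)$ is lexicographically smallest. A black-box solver is assumed that, given $\varepsilon$, returns the optimal image of $\Pi(\varepsilon)$, or reports that $\Pi(\varepsilon)$ is infeasible. Dummy images: for $t\in[k-1]$, $d^t$ is the vector of length $k$ with $d^t_t=\infty$ and $d^t_i=-\infty$ for $i\ne t$. (Equivalently one may use a finite number $M$ larger than the absolute values of all coordinates of elements of $Y_N$ instead of $\infty$.) Algorithm PEA: define a recursive function exploreSubtree$(\mathcal{Y})$ for a tuple $\mathcal{Y}=(\mathcal{Y}^1,\dots,\mathcal{Y}^{k-1})$ of images (elements of $Y_N\cup\{d^1,\dots,d^{k-1}\}$): 1. Set $S\leftarrow\emptyset$ and let $\varepsilon(\mathcal{Y})=(\mathcal{Y}^1_1,\mathcal{Y}^2_2,\dots,\mathcal{Y}^{k-1}_{k-1})$. Call the solver on $\Pi(\varepsilon(\mathcal{Y}))$. If it is infeasible, return $S=\emptyset$. Otherwise let $y^*$ be the optimal image. 2. If $\mathcal{Y}^i_{-[i]}\leq y^*_{-[i]}$ for all $i\in[k-1]$, set $S\leftarrow S\cup\{y^*\}$. 3. For each $j\in[k-1]$: if $y^*_j\ge\mathcal{Y}^i_j$ for all $i\in[k-1]\setminus\{j\}$, set $S\leftarrow S\,\cup\,$exploreSubtree$(\mathcal{Y}^1,\dots,\mathcal{Y}^{j-1},y^*,\mathcal{Y}^{j+1},\dots,\mathcal{Y}^{k-1})$. 4. Return $S$. PEA outputs exploreSubtree$(d^1,\dots,d^{k-1})$. *)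

theory Defs
  imports "HOL-Library.Extended_Real"
begin

text \<open>
  Vectors are lists, so a vector of length \<open>k\<close> has components \<open>y ! 0, \<dots>, y ! (k - 1)\<close>;
  all indices are shifted down by one with respect to the usual \<open>1, \<dots>, k\<close>.
  With this shift, dropping the last component of \<open>y\<close> is \<^term>\<open>butlast y\<close>, and the part of \<open>y\<close>
  strictly behind the component with (shifted) index \<open>i\<close> is \<^term>\<open>drop (Suc i) y\<close>.
\<close>

definition vec_less :: "'a::linorder list \<Rightarrow> 'a list \<Rightarrow> bool" where
  "vec_less a b \<longleftrightarrow> list_all2 (<) a b"

definition vec_dom :: "'a::linorder list \<Rightarrow> 'a list \<Rightarrow> bool" where
  "vec_dom a b \<longleftrightarrow> list_all2 (\<le>) a b \<and> a \<noteq> b"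

definition nondominated :: "real list set \<Rightarrow> real list set" where
  "nondominated Y = {y \<in> Y. \<not> (\<exists>y' \<in> Y. vec_dom y' y)}"

text \<open>
  The dimension \<open>n\<close> of the decision space is an ordinary natural number (and not a type), so that
  constants can be chosen uniformly in \<open>n\<close>.
\<close>

definition moip :: "nat \<Rightarrow> nat \<Rightarrow> int list set \<Rightarrow> (int list \<Rightarrow> real list) \<Rightarrow> bool" where
  "moip k n X f \<longleftrightarrow> (\<forall>x \<in> X. length x = n) \<and> (\<forall>x \<in> X. length (f x) = k)
     \<and> finite (nondominated (f ` X))"

text \<open>Below, \<open>N\<close> is the nondominated set.\<close>

definition feasible :: "real list set \<Rightarrow> ereal list \<Rightarrow> real list \<Rightarrow> bool" where
  "feasible N \<epsilon> y \<longleftrightarrow> y \<in> N \<and> vec_less (map ereal (butlast y)) \<epsilon>"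

text \<open>The objectives are minimized in the order last to first, hence \<^const>\<open>rev\<close>.\<close>

definition optimal_image :: "real list set \<Rightarrow> ereal list \<Rightarrow> real list \<Rightarrow> bool" where
  "optimal_image N \<epsilon> y \<longleftrightarrow>
     feasible N \<epsilon> y \<and> (\<forall>z. feasible N \<epsilon> z \<longrightarrow> ord_class.lexordp_eq (rev y) (rev z))"

definition is_solver :: "nat \<Rightarrow> real list set \<Rightarrow> (ereal list \<Rightarrow> real list option) \<Rightarrow> bool" where
  "is_solver k N solve \<longleftrightarrow>
     (\<forall>\<epsilon>. length \<epsilon> = k - 1 \<and> -\<infinity> \<notin> set \<epsilon> \<longrightarrow>
        (case solve \<epsilon> of
           None \<Rightarrow> \<not> (\<exists>y. feasible N \<epsilon> y)
         | Some y \<Rightarrow> optimal_image N \<epsilon> y))"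

definition dummy :: "nat \<Rightarrow> nat \<Rightarrow> ereal list" where
  "dummy k t = (replicate k (-\<infinity>))[t := \<infinity>]"

definition eps :: "nat \<Rightarrow> ereal list list \<Rightarrow> ereal list" where
  "eps k Ys = map (\<lambda>i. Ys ! i ! i) [0..<k - 1]"

definition keep :: "nat \<Rightarrow> ereal list list \<Rightarrow> ereal list \<Rightarrow> bool" where
  "keep k Ys y \<longleftrightarrow> (\<forall>i < k - 1. vec_dom (drop (Suc i) (Ys ! i)) (drop (Suc i) y))"

definition branches :: "nat \<Rightarrow> ereal list list \<Rightarrow> ereal list \<Rightarrow> nat set" where
  "branches k Ys y = {j. j < k - 1 \<and> (\<forall>i < k - 1. i \<noteq> j \<longrightarrow> y ! j \<ge> Ys ! i ! j)}"

text \<open>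
  The function returns the set of images found together with the number of calls to the solver.
  No termination proof is supplied: the recursion equation is available only on arguments
  in \<open>explore_dom\<close>, the accessible part of the call relation, and membership in this domain is what
  termination of the algorithm means. The congruence rule makes the call relation contain only the
  recursive calls for \<open>j\<close> in \<^const>\<open>branches\<close>, as intended.
\<close>

lemma UN_fundef_cong [fundef_cong]:
  "A = B \<Longrightarrow> (\<And>x. x \<in> B \<Longrightarrow> f x = g x) \<Longrightarrow> (\<Union>x\<in>A. f x) = (\<Union>x\<in>B. g x)"
  by simp

function (domintros) explore ::
  "nat \<Rightarrow> (ereal list \<Rightarrow> real list option) \<Rightarrow> ereal list list \<Rightarrow> real list set \<times> nat" where
  "explore k solve Ys =
     (case solve (eps k Ys) of
        None \<Rightarrow> ({}, 1)
      | Some y \<Rightarrow>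
          ((if keep k Ys (map ereal y) then {y} else {})
             \<union> (\<Union>j \<in> branches k Ys (map ereal y). fst (explore k solve (Ys[j := map ereal y]))),
           1 + (\<Sum>j \<in> branches k Ys (map ereal y). snd (explore k solve (Ys[j := map ereal y])))))"
  by pat_completeness auto

definition start :: "nat \<Rightarrow> ereal list list" where
  "start k = map (dummy k) [0..<k - 1]"

definition pea_terminates :: "nat \<Rightarrow> (ereal list \<Rightarrow> real list option) \<Rightarrow> bool" where
  "pea_terminates k solve \<longleftrightarrow> explore_dom (k, solve, start k)"

definition pea_output :: "nat \<Rightarrow> (ereal list \<Rightarrow> real list option) \<Rightarrow> real list set" where
  "pea_output k solve = fst (explore k solve (start k))"

definition pea_calls :: "nat \<Rightarrow> (ereal list \<Rightarrow> real list option) \<Rightarrow> nat" where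
  "pea_calls k solve = snd (explore k solve (start k))"

lemma ex_optimal_image:
  assumes "finite N" and "feasible N \<epsilon> y"
  shows "\<exists>z. optimal_image N \<epsilon> z"
proof -
  have "finite A \<Longrightarrow> A \<noteq> {} \<Longrightarrow> \<exists>z\<in>A. \<forall>w\<in>A. ord_class.lexordp_eq (rev z) (rev w)"
    for A :: "real list set"
  proof (induction A rule: finite_ne_induct)
    case (singleton x)
    then show ?case by (simp add: lexordp_eq_refl)
  next
    case (insert x F)
    then obtain z where "z \<in> F" "\<forall>w\<in>F. ord_class.lexordp_eq (rev z) (rev w)" by blast
    moreover have "ord_class.lexordp_eq (rev z) (rev x) \<or> ord_class.lexordp_eq (rev x) (rev z)"
      by (rule lexordp_eq_linear)
    ultimately show ?case by (metis insert_iff lexordp_eq_refl lexordp_eq_trans)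
  qed
  from this[of "{z. feasible N \<epsilon> z}"] assms show ?thesis
    by (auto simp: optimal_image_def feasible_def)
qed

lemma optimal_image_unique:
  assumes "optimal_image N \<epsilon> y" and "optimal_image N \<epsilon> z"
  shows "y = z"
  using assms lexordp_eq_antisym[of "rev y" "rev z"] by (auto simp: optimal_image_def)

lemma ex_solver:
  assumes "finite N"
  shows "\<exists>solve. is_solver k N solve"
proof
  show "is_solver k N (\<lambda>\<epsilon>. if \<exists>y. feasible N \<epsilon> y then Some (SOME y. optimal_image N \<epsilon> y) else None)"
    using ex_optimal_image[OF assms] by (auto simp: is_solver_def intro: someI_ex)
qed

end

theory Submission
  imports Defs "HOL-Library.FuncSet"
begin

text \<open>
  Ties in a coordinate are broken by the time at which the solver would return an image, that is,
  by the lexicographic order of the reversed vectors, which also serves as the order of the last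
  coordinate. A call of the algorithm together with the image returned by the solver (or a dummy,
  if the problem is infeasible) is then a local upper bound in dimension \<open>k\<close>: a tuple
  \<open>(p\<^sub>1, \<dots>, p\<^sub>k)\<close> in which \<open>p\<^sub>i\<close> is strictly largest in coordinate \<open>i\<close>, and whose open box
  contains no image. The parent of a call can be recovered from its tuple, so the calls correspond
  bijectively to certain local upper bounds. Conversely every local upper bound for the images
  found before a given time occurs in the tree, and for each nondominated \<open>y\<close> a
  suitable one passes the test in step 2 when \<open>y\<close> is returned.

  To count local upper bounds, let \<open>\<pi>(l) < l\<close> be the index of the largest point in coordinate \<open>l\<close>
  among \<open>p\<^sub>1, \<dots>, p\<^bsub>l-1\<^esub>\<close>, and colour the indices with two colours such that \<open>l\<close> and \<open>\<pi>(l)\<close>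
  always differ. The points in either colour class determine the whole tuple, and the smaller class
  has at most \<open>\<lfloor>k/2\<rfloor>\<close> elements, so there are at most \<open>2\<^sup>k (|Y\<^sub>N| + 1)\<^bsup>\<lfloor>k/2\<rfloor>\<^esup>\<close> local upper bounds.
\<close>

section \<open>Counting local upper bounds\<close>

text \<open>\<open>K\<close> is one class of a proper 2-colouring of the tree joining each
  \<open>l\<close> to its witness \<open>a\<close>. The witness is existential because equal entries
  leave its index ambiguous.\<close>

definition alternating :: "(nat \<Rightarrow> 'a \<Rightarrow> 'a \<Rightarrow> bool) \<Rightarrow> nat \<Rightarrow> nat set \<Rightarrow> 'a list \<Rightarrow> bool" where
  "alternating L k K p \<longleftrightarrow>
     (\<forall>l. 0 < l \<and> l < k \<longrightarrow>
        (\<exists>a<l. (\<forall>m<l. p ! m = p ! a \<or> L l (p ! m) (p ! a)) \<and> (a \<in> K \<longleftrightarrow> l \<notin> K)))"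

text \<open>Colouring greedily, each new index gets the colour opposite to that of its witness. The
  condition is invariant under complement, so the smaller class can be taken.\<close>

lemma ex_alternating:
  fixes L :: "nat \<Rightarrow> 'a \<Rightarrow> 'a \<Rightarrow> bool"
  assumes "\<And>l. transp (L l)" and "\<And>l. totalp (L l)" and "\<And>l. irreflp (L l)"
  obtains K where "K \<subseteq> {..<k}" and "card K \<le> k div 2" and "alternating L k K p"
proof -
  have "\<exists>K \<subseteq> {..<n}. alternating L n K p" for n
  proof (induction n)
    case 0
    show ?case by (intro exI[of _ "{}"]) (auto simp: alternating_def)
  next
    case (Suc n)
    then obtain K where K: "K \<subseteq> {..<n}" "alternating L n K p" by blast
    show ?case
    proof (cases "n = 0")
      case True
      then show ?thesis by (intro exI[of _ "{}"]) (auto simp: alternating_def)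
    next
      case False
      let ?A = "(!) p ` {..<n}"
      have "asymp (L n)"
        using assms(1)[of n] assms(3)[of n] by (auto intro!: asympI dest: transpD irreflpD)
      then have "\<exists>m\<in>?A. \<forall>x\<in>?A. x \<noteq> m \<longrightarrow> \<not> L n m x"
        using False asymp_on_subset[OF _ subset_UNIV] transp_on_subset[OF assms(1) subset_UNIV]
        by (intro Finite_Set.bex_max_element) auto
      then obtain a where a: "a < n" "\<forall>m<n. p ! m = p ! a \<or> \<not> L n (p ! a) (p ! m)" by auto
      then have max: "\<forall>m<n. p ! m = p ! a \<or> L n (p ! m) (p ! a)"
        using assms(2)[of n] by (auto dest: totalpD)
      define K' where "K' = (if a \<in> K then K else insert n K)"
      have same: "l \<in> K' \<longleftrightarrow> l \<in> K" if "l < n" for l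
        using that by (auto simp: K'_def)
      have "n \<in> K' \<longleftrightarrow> a \<notin> K'"
        using K(1) a(1) by (auto simp: K'_def)
      moreover have "K' \<subseteq> {..<Suc n}"
        using K(1) by (auto simp: K'_def)
      moreover have "alternating L (Suc n) K' p"
        unfolding alternating_def
      proof (intro allI impI)
        fix l assume l: "0 < l \<and> l < Suc n"
        show "\<exists>a<l. (\<forall>m<l. p ! m = p ! a \<or> L l (p ! m) (p ! a)) \<and> (a \<in> K' \<longleftrightarrow> l \<notin> K')"
        proof (cases "l = n")
          case True
          then show ?thesis using a(1) max calculation(1) by (intro exI[of _ a]) simp
        next
          case False
          then have "l < n" using l by simp
          then obtain b where "b < l" "\<forall>m<l. p ! m = p ! b \<or> L l (p ! m) (p ! b)"
            "b \<in> K \<longleftrightarrow> l \<notin> K"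
            using K(2)[unfolded alternating_def, rule_format, of l] l by auto
          then show ?thesis using same \<open>l < n\<close> by (intro exI[of _ b]) auto
        qed
      qed
      ultimately show ?thesis by (intro exI[of _ K'] conjI)
    qed
  qed
  then obtain K where K: "K \<subseteq> {..<k}" "alternating L k K p" by blast
  have "card K + card ({..<k} - K) = k"
    using card_Un_disjoint[of K "{..<k} - K"] K(1) finite_subset[OF K(1)]
    by (simp add: Un_absorb1)
  then consider "card K \<le> k div 2" | "card ({..<k} - K) \<le> k div 2" by linarith
  then show thesis
  proof cases
    case 1
    then show ?thesis using K by (intro that[of K])
  next
    case 2
    have "alternating L k ({..<k} - K) p"
      unfolding alternating_def
    proof (intro allI impI)
      fix l assume l: "0 < l \<and> l < k"
      then obtain a where "a < l" "\<forall>m<l. p ! m = p ! a \<or> L l (p ! m) (p ! a)" "a \<in> K \<longleftrightarrow> l \<notin> K"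
        using K(2)[unfolded alternating_def, rule_format, of l] by auto
      then show "\<exists>a<l. (\<forall>m<l. p ! m = p ! a \<or> L l (p ! m) (p ! a)) \<and>
          (a \<in> {..<k} - K \<longleftrightarrow> l \<notin> {..<k} - K)"
        using l by (intro exI[of _ a]) auto
    qed
    then show ?thesis using 2 by (intro that[of "{..<k} - K"]) auto
  qed
qed

definition local_upper_bound ::
  "(nat \<Rightarrow> 'a \<Rightarrow> 'a \<Rightarrow> bool) \<Rightarrow> nat \<Rightarrow> 'a set \<Rightarrow> (nat \<Rightarrow> 'a) \<Rightarrow> 'a list \<Rightarrow> bool" where
  "local_upper_bound L k P hi p \<longleftrightarrow>
     length p = k \<and> (\<forall>i<k. p ! i \<in> insert (hi i) P) \<and>
     (\<forall>i<k. \<forall>l<k. i \<noteq> l \<longrightarrow> L l (p ! i) (p ! l)) \<and>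
     (\<forall>z\<in>P. \<exists>l<k. \<not> L l z (p ! l))"

text \<open>
  Consider the first index \<open>m\<close> at which the two tuples differ, say with \<open>p ! m\<close> below \<open>q ! m\<close>.
  The point \<open>p ! m\<close> lies outside the box of \<open>q\<close>, and this can only be witnessed by a coordinate
  \<open>l > m\<close>. Either \<open>l\<close> or the index of the largest earlier point in coordinate \<open>l\<close> is in \<open>K\<close>,
  where the tuples agree, and both cases are contradictory.
\<close>

lemma local_upper_bound_eqI_aux:
  fixes L :: "nat \<Rightarrow> 'a \<Rightarrow> 'a \<Rightarrow> bool"
  assumes "\<And>l. transp (L l)"
    and hi: "\<And>i z. i < k \<Longrightarrow> z \<in> insert (hi i) P \<Longrightarrow> \<not> L i (hi i) z"
    and p: "local_upper_bound L k P hi p" "alternating L k K p"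
    and q: "local_upper_bound L k P hi q"
    and agree: "\<And>i. i < k \<Longrightarrow> i \<in> K \<Longrightarrow> p ! i = q ! i"
    and m: "m < k" "\<And>i. i < m \<Longrightarrow> p ! i = q ! i" "L m (p ! m) (q ! m)"
  shows False
proof -
  have "p ! m \<noteq> hi m"
    using hi[of m "q ! m"] m(1,3) q by (auto simp: local_upper_bound_def)
  then have "p ! m \<in> P"
    using p(1) m(1) by (auto simp: local_upper_bound_def)
  then obtain l where l: "l < k" "\<not> L l (p ! m) (q ! l)"
    using q by (auto simp: local_upper_bound_def)
  have below: "l \<noteq> m \<Longrightarrow> L l (p ! m) (p ! l)"
    using p(1) l(1) m(1) by (auto simp: local_upper_bound_def)
  have "m < l"
    using l(2) below m(2,3) by (metis linorder_neqE_nat)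
  then obtain a where a: "a < l" "p ! m = p ! a \<or> L l (p ! m) (p ! a)" "a \<in> K \<longleftrightarrow> l \<notin> K"
    using p(2) l(1) unfolding alternating_def by (metis gr_zeroI not_less_zero)
  show False
  proof (cases "l \<in> K")
    case True
    then show ?thesis using agree l below \<open>m < l\<close> by auto
  next
    case False
    then have "p ! a = q ! a" using a l(1) agree by simp
    moreover have "L l (q ! a) (q ! l)"
      using q a(1) l(1) by (auto simp: local_upper_bound_def)
    ultimately show ?thesis using a(2) l(2) assms(1) by (metis transpD)
  qed
qed

text \<open>Totality of \<open>L m\<close> at the first difference \<open>m\<close> leaves two
  symmetric cases. Which tuple is lower there is unknown, so both are taken to alternate for the
  same \<open>K\<close>.\<close>

lemma local_upper_bound_eqI:
  fixes L :: "nat \<Rightarrow> 'a \<Rightarrow> 'a \<Rightarrow> bool"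
  assumes "\<And>l. transp (L l)" and "\<And>l. totalp (L l)"
    and "\<And>i z. i < k \<Longrightarrow> z \<in> insert (hi i) P \<Longrightarrow> \<not> L i (hi i) z"
    and "local_upper_bound L k P hi p" "alternating L k K p"
    and "local_upper_bound L k P hi q" "alternating L k K q"
    and "\<And>i. i < k \<Longrightarrow> i \<in> K \<Longrightarrow> p ! i = q ! i"
  shows "p = q"
proof (rule ccontr)
  assume "p \<noteq> q"
  moreover have "length p = k" "length q = k"
    using assms(4,6) by (auto simp: local_upper_bound_def)
  ultimately have ex: "\<exists>i. i < k \<and> p ! i \<noteq> q ! i" by (metis nth_equalityI)
  define m where "m = (LEAST i. i < k \<and> p ! i \<noteq> q ! i)"
  have m: "m < k" "p ! m \<noteq> q ! m"
    using LeastI_ex[OF ex] by (simp_all add: m_def)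
  have eq: "p ! i = q ! i" if "i < m" for i
    using that m(1) not_less_Least[of i "\<lambda>i. i < k \<and> p ! i \<noteq> q ! i"] by (auto simp: m_def)
  consider "L m (p ! m) (q ! m)" | "L m (q ! m) (p ! m)"
    using m(2) assms(2) by (metis totalpD)
  then show False
  proof cases
    case 1
    show ?thesis
      by (rule local_upper_bound_eqI_aux[where L = L and p = p and q = q and m = m and K = K])
        (use assms m eq 1 in auto)
  next
    case 2
    show ?thesis
      by (rule local_upper_bound_eqI_aux[where L = L and p = q and q = p and m = m and K = K])
        (use assms m eq 2 in auto)
  qed
qed

text \<open>For fixed \<open>K\<close>, restriction to \<open>K\<close> is injective on the tuples
  alternating for \<open>K\<close>, with at most \<open>card P + 1\<close> values per index. At most
  \<open>2 ^ k\<close> sets \<open>K\<close> are possible.\<close>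

lemma card_local_upper_bounds:
  fixes L :: "nat \<Rightarrow> 'a \<Rightarrow> 'a \<Rightarrow> bool"
  assumes L: "\<And>l. transp (L l)" "\<And>l. totalp (L l)" "\<And>l. irreflp (L l)"
    and hi: "\<And>i z. i < k \<Longrightarrow> z \<in> insert (hi i) P \<Longrightarrow> \<not> L i (hi i) z"
    and "finite P"
    and V: "\<And>p. p \<in> V \<Longrightarrow> local_upper_bound L k P hi p"
  shows "card V \<le> 2 ^ k * (card P + 1) ^ (k div 2)"
proof -
  define \<K> where "\<K> = {K. K \<subseteq> {..<k} \<and> card K \<le> k div 2}"
  define W where "W K = {p \<in> V. alternating L k K p}" for K
  have fin\<K>: "finite \<K>" by (rule finite_subset[of _ "Pow {..<k}"]) (auto simp: \<K>_def)
  have W: "finite (W K) \<and> card (W K) \<le> (card P + 1) ^ (k div 2)" if "K \<in> \<K>" for K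
  proof -
    have K: "K \<subseteq> {..<k}" "card K \<le> k div 2" "finite K"
      using that finite_subset by (auto simp: \<K>_def)
    let ?F = "PiE K (\<lambda>i. insert (hi i) P)"
    let ?r = "\<lambda>p. restrict ((!) p) K"
    have "inj_on ?r (W K)"
    proof (rule inj_onI)
      fix p q assume pq: "p \<in> W K" "q \<in> W K" and eq: "?r p = ?r q"
      have "p ! i = q ! i" if "i \<in> K" for i
        using fun_cong[OF eq, of i] that by simp
      then show "p = q"
        using local_upper_bound_eqI[of L k hi P p K q] L hi V pq by (auto simp: W_def)
    qed
    moreover have "?r ` W K \<subseteq> ?F"
    proof (intro image_subsetI restrict_PiE_iff[THEN iffD2] ballI)
      fix p i assume "p \<in> W K" "i \<in> K"
      then have "local_upper_bound L k P hi p" "i < k" using V K(1) by (auto simp: W_def)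
      then show "p ! i \<in> insert (hi i) P" by (simp add: local_upper_bound_def)
    qed
    moreover have "finite ?F"
      using K(3) \<open>finite P\<close> by (intro finite_PiE) auto
    ultimately have "finite (W K)" "card (W K) \<le> card ?F"
      by (auto dest: inj_on_finite intro: card_inj_on_le)
    moreover have "card ?F = (\<Prod>i\<in>K. card (insert (hi i) P))"
      using K(3) by (rule card_PiE)
    moreover have "\<dots> \<le> (\<Prod>i\<in>K. card P + 1)"
      by (intro prod_mono) (auto simp: card_insert_if \<open>finite P\<close>)
    moreover have "\<dots> \<le> (card P + 1) ^ (k div 2)"
      using K(2) by (simp add: power_increasing)
    ultimately show ?thesis by linarith
  qed
  have "V \<subseteq> (\<Union>K\<in>\<K>. W K)"
  proof
    fix p assume "p \<in> V"
    moreover obtain K where "K \<subseteq> {..<k}" "card K \<le> k div 2" "alternating L k K p"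
      by (rule ex_alternating[OF L])
    moreover from this have "K \<in> \<K>" by (simp add: \<K>_def)
    ultimately show "p \<in> (\<Union>K\<in>\<K>. W K)" by (auto simp: W_def)
  qed
  then have "card V \<le> card (\<Union>K\<in>\<K>. W K)"
    using W fin\<K> by (intro card_mono) auto
  also have "\<dots> \<le> (\<Sum>K\<in>\<K>. card (W K))"
    by (rule card_UN_le[OF fin\<K>])
  also have "\<dots> \<le> (\<Sum>K\<in>\<K>. (card P + 1) ^ (k div 2))"
    using W by (intro sum_mono) auto
  also have "\<dots> = card \<K> * (card P + 1) ^ (k div 2)" by simp
  also have "card \<K> \<le> card (Pow {..<k})"
    by (intro card_mono) (auto simp: \<K>_def)
  finally show ?thesis by (simp add: card_Pow)
qed

section \<open>Breaking ties\<close>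

definition earlier :: "'a::linorder list \<Rightarrow> 'a list \<Rightarrow> bool" where
  "earlier a b \<longleftrightarrow> ord_class.lexordp (rev a) (rev b)"

definition coord_less :: "nat \<Rightarrow> 'a::linorder list \<Rightarrow> 'a list \<Rightarrow> bool" where
  "coord_less i a b \<longleftrightarrow> a ! i < b ! i \<or> a ! i = b ! i \<and> earlier a b"

lemma earlier_irrefl [simp]: "\<not> earlier a a"
  by (simp add: earlier_def lexordp_irreflexive')

lemma earlier_trans: "earlier a b \<Longrightarrow> earlier b c \<Longrightarrow> earlier a c"
  unfolding earlier_def by (rule lexordp_trans)

lemma earlier_linear: "earlier a b \<or> a = b \<or> earlier b a"
  unfolding earlier_def using lexordp_linear[of "rev a" "rev b"] by auto

lemma earlier_eq_iff: "ord_class.lexordp_eq (rev a) (rev b) \<longleftrightarrow> \<not> earlier b a"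
  unfolding earlier_def by (meson lexordp_conv_lexordp_eq lexordp_eq_linear)

lemma earlier_iff:
  "length a = n \<Longrightarrow> length b = n \<Longrightarrow>
     earlier a b \<longleftrightarrow> (\<exists>j<n. a ! j < b ! j \<and> (\<forall>l. j < l \<and> l < n \<longrightarrow> a ! l = b ! l))"
proof (induction n arbitrary: a b)
  case 0
  then show ?case by (simp add: earlier_def)
next
  case (Suc n)
  obtain a' x where a: "a = a' @ [x]" using Suc.prems(1) by (cases a rule: rev_cases) auto
  obtain b' y where b: "b = b' @ [y]" using Suc.prems(2) by (cases b rule: rev_cases) auto
  have len: "length a' = n" "length b' = n" using Suc.prems a b by auto
  have "earlier a b \<longleftrightarrow> x < y \<or> x = y \<and> earlier a' b'"
    by (auto simp: earlier_def a b)
  also have "\<dots> \<longleftrightarrow> (\<exists>j<Suc n. a ! j < b ! j \<and> (\<forall>l. j < l \<and> l < Suc n \<longrightarrow> a ! l = b ! l))"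
    (is "_ \<longleftrightarrow> (\<exists>j<Suc n. ?Q j)")
  proof -
    have "?Q n \<longleftrightarrow> x < y"
      using len by (auto simp: a b nth_append)
    moreover have "?Q j \<longleftrightarrow>
        x = y \<and> a' ! j < b' ! j \<and> (\<forall>l. j < l \<and> l < n \<longrightarrow> a' ! l = b' ! l)" if "j < n" for j
      using len that by (auto simp: a b nth_append less_Suc_eq)
    ultimately show ?thesis
      using Suc.IH[OF len] by (auto simp: less_Suc_eq)
  qed
  finally show ?case .
qed

lemma earlier_map_ereal [simp]:
  assumes "length a = length b"
  shows "earlier (map ereal a) (map ereal b) \<longleftrightarrow> earlier a b"
  using assms earlier_iff[of a "length b" b]
    earlier_iff[of "map ereal a" "length b" "map ereal b"] by auto

lemma coord_less_irrefl [simp]: "\<not> coord_less i a a"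
  by (simp add: coord_less_def)

lemma coord_less_trans: "coord_less i a b \<Longrightarrow> coord_less i b c \<Longrightarrow> coord_less i a c"
  unfolding coord_less_def by (auto intro: earlier_trans)

lemma coord_less_linear: "coord_less i a b \<or> a = b \<or> coord_less i b a"
  unfolding coord_less_def using earlier_linear[of a b] by (cases "a ! i" "b ! i" rule: linorder_cases) auto

lemma coord_less_imp_le: "coord_less i a b \<Longrightarrow> a ! i \<le> b ! i"
  by (auto simp: coord_less_def)

lemma ex_coord_least:
  assumes "finite A" "A \<noteq> {}"
  obtains m where "m \<in> A" "\<And>z. z \<in> A \<Longrightarrow> \<not> coord_less i z m"
proof -
  have "\<exists>m\<in>A. \<forall>z\<in>A. z \<noteq> m \<longrightarrow> \<not> coord_less i z m"
    using assms(1) _ _ assms(2)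
    by (rule Finite_Set.bex_min_element)
      (auto intro!: asymp_onI transp_onI dest: coord_less_trans)
  then show thesis using that by (metis coord_less_irrefl)
qed

lemma drop_dom_iff:
  assumes "length a = k" "length b = k" "i < k"
  shows "vec_dom (drop (Suc i) a) (drop (Suc i) b) \<longleftrightarrow>
    (\<forall>l. i < l \<and> l < k \<longrightarrow> a ! l \<le> b ! l) \<and> (\<exists>l. i < l \<and> l < k \<and> a ! l < b ! l)"
proof -
  have shift: "(\<forall>m < k - Suc i. P (Suc (i + m))) \<longleftrightarrow> (\<forall>l. i < l \<and> l < k \<longrightarrow> P l)" for P
  proof
    assume P: "\<forall>m < k - Suc i. P (Suc (i + m))"
    show "\<forall>l. i < l \<and> l < k \<longrightarrow> P l"
    proof (intro allI impI)
      fix l assume "i < l \<and> l < k"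
      then show "P l" using P[rule_format, of "l - Suc i"] by auto
    qed
  qed auto
  have "vec_dom (drop (Suc i) a) (drop (Suc i) b) \<longleftrightarrow>
      (\<forall>m < k - Suc i. a ! Suc (i + m) \<le> b ! Suc (i + m)) \<and>
      \<not> (\<forall>m < k - Suc i. a ! Suc (i + m) = b ! Suc (i + m))"
    using assms by (simp add: vec_dom_def list_all2_conv_all_nth list_eq_iff_nth_eq)
  also have "\<dots> \<longleftrightarrow> (\<forall>l. i < l \<and> l < k \<longrightarrow> a ! l \<le> b ! l) \<and>
      \<not> (\<forall>l. i < l \<and> l < k \<longrightarrow> a ! l = b ! l)"
    unfolding shift[of "\<lambda>l. a ! l \<le> b ! l"] shift[of "\<lambda>l. a ! l = b ! l"] ..
  finally show ?thesis by (metis order_le_less order_less_irrefl)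
qed

text \<open>The comparison runs from the end, so it is decided among the entries behind
  \<open>i\<close>, where the last difference favours \<open>a\<close>.\<close>

lemma drop_dom_imp_earlier:
  assumes "length a = k" "length b = k" "i < k" "vec_dom (drop (Suc i) a) (drop (Suc i) b)"
  shows "earlier a b"
proof -
  have "\<not> earlier b a"
  proof
    assume "earlier b a"
    then obtain j where j: "b ! j < a ! j" "j < k" "\<forall>l. j < l \<and> l < k \<longrightarrow> b ! l = a ! l"
      using earlier_iff[OF assms(2,1)] by auto
    obtain l where "i < l" "l < k" "a ! l < b ! l" "\<forall>l. i < l \<and> l < k \<longrightarrow> a ! l \<le> b ! l"
      using assms(4) drop_dom_iff[OF assms(1-3)] by auto
    then show False using j by (cases "i < j") (auto simp: not_less)
  qed
  moreover have "a \<noteq> b" using assms(4) by (auto simp: vec_dom_def)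
  ultimately show ?thesis using earlier_linear by blast
qed

section \<open>The search tree\<close>

locale pea_run =
  fixes k :: nat and N :: "real list set" and solve :: "ereal list \<Rightarrow> real list option"
  assumes k2: "k \<ge> 2"
    and fin: "finite N"
    and len: "\<And>y. y \<in> N \<Longrightarrow> length y = k"
    and antichain: "\<And>y z. y \<in> N \<Longrightarrow> z \<in> N \<Longrightarrow> \<not> vec_dom z y"
    and solver: "is_solver k N solve"
begin

definition E :: "ereal list set" where
  "E = map ereal ` N"

text \<open>\<open>box\<close> is the feasible region as the solver sees it; \<open>weak_box\<close>
  is its tie-broken enlargement, used as the open box of the local upper bound.\<close>

definition box :: "ereal list list \<Rightarrow> ereal list \<Rightarrow> bool" where
  "box Ys z \<longleftrightarrow> (\<forall>i<k - 1. z ! i < Ys ! i ! i)"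

definition weak_box :: "ereal list list \<Rightarrow> ereal list \<Rightarrow> bool" where
  "weak_box Ys z \<longleftrightarrow> (\<forall>i<k - 1. coord_less i z (Ys ! i))"

text \<open>The dummy with index \<open>k - 1\<close> is never an entry of a call. It is later than
  every image and completes the tuple of an infeasible call.\<close>

definition opt :: "ereal list list \<Rightarrow> ereal list" where
  "opt Ys = (case solve (eps k Ys) of None \<Rightarrow> dummy k (k - 1) | Some y \<Rightarrow> map ereal y)"

definition corner :: "ereal list list \<Rightarrow> bool" where
  "corner Ys \<longleftrightarrow> length Ys = k - 1 \<and> (\<forall>i<k - 1. Ys ! i \<in> insert (dummy k i) E) \<and>
     (\<forall>i<k - 1. \<forall>l<k - 1. i \<noteq> l \<longrightarrow> coord_less l (Ys ! i) (Ys ! l))"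

text \<open>
  The last conjunct says that tie-breaking does not enlarge the feasible set of a node.
\<close>

definition node :: "ereal list list \<Rightarrow> bool" where
  "node Ys \<longleftrightarrow> corner Ys \<and> (\<forall>i<k - 1. earlier (Ys ! i) (opt Ys)) \<and>
     (\<forall>z\<in>E. weak_box Ys z \<longrightarrow> box Ys z)"

definition child :: "ereal list list \<Rightarrow> ereal list list \<Rightarrow> bool" where
  "child Ys Zs \<longleftrightarrow> (\<exists>y. solve (eps k Ys) = Some y \<and>
     (\<exists>j\<in>branches k Ys (map ereal y). Zs = Ys[j := map ereal y]))"

section \<open>Images, dummies and the solver\<close>

lemma finite_E [simp]: "finite E"
  by (simp add: E_def fin)

lemma card_E: "card E = card N"
  unfolding E_def by (intro card_image inj_onI) (auto simp: inj_map_eq_map inj_def)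

lemma length_E: "z \<in> E \<Longrightarrow> length z = k"
  by (auto simp: E_def len)

lemma nth_E: "z \<in> E \<Longrightarrow> i < k \<Longrightarrow> - \<infinity> < z ! i \<and> z ! i < \<infinity>"
  by (auto simp: E_def len)

lemma length_dummy [simp]: "length (dummy k t) = k"
  by (simp add: dummy_def)

lemma nth_dummy: "i < k \<Longrightarrow> dummy k t ! i = (if i = t then \<infinity> else - \<infinity>)"
  by (simp add: dummy_def nth_list_update)

lemma dummy_notin_E: "t < k \<Longrightarrow> dummy k t \<notin> E"
  using nth_E[of "dummy k t" t] by (auto simp: nth_dummy)

lemma earlier_lastI:
  assumes "length a = k" "length b = k" "a ! (k - 1) < b ! (k - 1)"
  shows "earlier a b"
proof -
  have "\<exists>j<k. a ! j < b ! j \<and> (\<forall>l. j < l \<and> l < k \<longrightarrow> a ! l = b ! l)"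
    by (rule exI[of _ "k - 1"]) (use assms(3) k2 in auto)
  then show ?thesis using earlier_iff[OF assms(1,2)] by simp
qed

lemma dummy_earlier_E: "i < k - 1 \<Longrightarrow> z \<in> E \<Longrightarrow> earlier (dummy k i) z"
  using nth_E[of z "k - 1"] by (intro earlier_lastI) (auto simp: nth_dummy length_E)

lemma dummy_earlier_dummy: "i < k - 1 \<Longrightarrow> earlier (dummy k i) (dummy k (k - 1))"
  by (intro earlier_lastI) (auto simp: nth_dummy)

lemma E_earlier_dummy: "z \<in> E \<Longrightarrow> earlier z (dummy k (k - 1))"
  using nth_E[of z "k - 1"] k2 by (intro earlier_lastI) (auto simp: nth_dummy length_E)

text \<open>\<open>is_solver\<close> promises nothing for bounds equal to minus infinity; diagonal
  entries avoid this value, coming from images or from dummies of matching index.\<close>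

lemma corner_bound_gt: "corner Ys \<Longrightarrow> i < k - 1 \<Longrightarrow> - \<infinity> < Ys ! i ! i"
  using nth_E[of "Ys ! i" i] nth_dummy[of i i] by (force simp: corner_def)

lemma box_imp_weak_box: "box Ys z \<Longrightarrow> weak_box Ys z"
  by (simp add: box_def weak_box_def coord_less_def)

lemma feasible_iff:
  "feasible N (eps k Ys) y \<longleftrightarrow> y \<in> N \<and> box Ys (map ereal y)"
proof -
  have "vec_less (map ereal (butlast y)) (eps k Ys) \<longleftrightarrow> box Ys (map ereal y)" if "y \<in> N"
    using len[OF that]
    by (auto simp: vec_less_def list_all2_conv_all_nth eps_def box_def nth_butlast)
  then show ?thesis by (auto simp: feasible_def)
qed

lemma eps_valid: "corner Ys \<Longrightarrow> length (eps k Ys) = k - 1 \<and> - \<infinity> \<notin> set (eps k Ys)"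
  using corner_bound_gt[of Ys] by (force simp: eps_def)

lemma solve_None: "corner Ys \<Longrightarrow> solve (eps k Ys) = None \<Longrightarrow> z \<in> E \<Longrightarrow> \<not> box Ys z"
  using solver eps_valid[of Ys] feasible_iff by (force simp: is_solver_def E_def)

lemma solve_Some:
  assumes "corner Ys" "solve (eps k Ys) = Some y"
  shows "y \<in> N" "box Ys (map ereal y)"
    and "z \<in> E \<Longrightarrow> box Ys z \<Longrightarrow> \<not> earlier z (map ereal y)"
proof -
  have opt: "optimal_image N (eps k Ys) y"
    using solver eps_valid[OF assms(1)] assms(2) by (force simp: is_solver_def)
  then show y: "y \<in> N" "box Ys (map ereal y)"
    by (auto simp: optimal_image_def feasible_iff)
  assume "z \<in> E" "box Ys z"
  then obtain x where x: "z = map ereal x" "x \<in> N" "feasible N (eps k Ys) x"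
    by (auto simp: E_def feasible_iff)
  then have "\<not> earlier x y"
    using opt by (simp add: optimal_image_def earlier_eq_iff)
  then show "\<not> earlier z (map ereal y)" using x y len by simp
qed

lemma opt_cases:
  assumes "corner Ys"
  obtains "solve (eps k Ys) = None" "opt Ys = dummy k (k - 1)" "\<And>z. z \<in> E \<Longrightarrow> \<not> box Ys z"
  | y where "solve (eps k Ys) = Some y" "opt Ys = map ereal y" "opt Ys \<in> E" "box Ys (opt Ys)"
    "\<And>z. z \<in> E \<Longrightarrow> box Ys z \<Longrightarrow> z = opt Ys \<or> earlier (opt Ys) z"
proof (cases "solve (eps k Ys)")
  case None
  then show ?thesis using that(1) solve_None[OF assms] by (simp add: opt_def)
next
  case (Some y)
  then have [simp]: "opt Ys = map ereal y" by (simp add: opt_def)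
  show ?thesis
    using that(2)[OF Some] solve_Some[OF assms Some] earlier_linear by (auto simp: E_def)
qed

lemma opt_eqI:
  assumes "corner Ys" "x \<in> E" "box Ys x" "\<And>z. z \<in> E \<Longrightarrow> box Ys z \<Longrightarrow> \<not> earlier z x"
  shows "opt Ys = x"
  using assms(1)
proof (cases rule: opt_cases)
  case 1
  then show ?thesis using assms by blast
next
  case (2 y)
  then show ?thesis using assms by metis
qed

lemma solve_of_opt:
  assumes "corner Ys" "opt Ys \<in> E"
  obtains y where "solve (eps k Ys) = Some y" "opt Ys = map ereal y"
  using assms dummy_notin_E[of "k - 1"] k2 by (cases rule: opt_cases[OF assms(1)]) auto

text \<open>The last conjunct of \<open>node\<close> passes to the solver's box, in which
  \<open>opt Ys\<close> is the earliest image or there is no image at all.\<close>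

lemma node_empty:
  assumes "node Ys" "z \<in> E" "earlier z (opt Ys)"
  shows "\<not> weak_box Ys z"
proof
  assume "weak_box Ys z"
  then have "box Ys z" using assms by (simp add: node_def)
  have "corner Ys" using assms by (simp add: node_def)
  then show False
  proof (cases rule: opt_cases)
    case 1
    then show ?thesis using \<open>box Ys z\<close> assms by blast
  next
    case (2 y)
    then show ?thesis using \<open>box Ys z\<close> assms by (metis earlier_irrefl earlier_trans)
  qed
qed

section \<open>Preservation of the invariant by recursive calls\<close>

lemma childE:
  assumes "child Ys Zs" "node Ys"
  obtains j where "j < k - 1" "opt Ys \<in> E" "box Ys (opt Ys)" "Zs = Ys[j := opt Ys]"
    "\<And>i. i < k - 1 \<Longrightarrow> i \<noteq> j \<Longrightarrow> Ys ! i ! j \<le> opt Ys ! j"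
proof -
  obtain y j where y: "solve (eps k Ys) = Some y" and j: "j \<in> branches k Ys (map ereal y)"
    and Zs: "Zs = Ys[j := map ereal y]"
    using assms(1) by (auto simp: child_def)
  have opt: "opt Ys = map ereal y" using y by (simp add: opt_def)
  have "corner Ys" using assms(2) by (simp add: node_def)
  from solve_Some[OF this y] show thesis
    using that[of j] j Zs by (auto simp: opt branches_def E_def)
qed

lemma box_child:
  assumes "j < k - 1" "box Ys x" "length Ys = k - 1" "box (Ys[j := x]) z"
  shows "box Ys z" "z ! j < x ! j"
proof -
  show less: "z ! j < x ! j" using assms by (auto simp: box_def)
  show "box Ys z"
    unfolding box_def
  proof (intro allI impI)
    fix i assume "i < k - 1"
    then show "z ! i < Ys ! i ! i"
      using assms less by (cases "i = j") (fastforce simp: box_def nth_list_update)+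
  qed
qed

text \<open>The new image is later than all old entries, so the non-strict test in step 3 becomes
  strict after tie-breaking. Images left in the box are not earlier than the new one, so a tie with
  the new bound cannot enlarge the feasible set.\<close>

lemma node_child:
  assumes "child Ys Zs" "node Ys"
  shows "node Zs"
proof -
  obtain j where j: "j < k - 1" and x: "opt Ys \<in> E" "box Ys (opt Ys)"
    and Zs: "Zs = Ys[j := opt Ys]"
    and br: "\<And>i. i < k - 1 \<Longrightarrow> i \<noteq> j \<Longrightarrow> Ys ! i ! j \<le> opt Ys ! j"
    by (rule childE[OF assms]) blast
  define x where "x = opt Ys"
  note x = x[folded x_def] and Zs = Zs[folded x_def] and br = br[folded x_def]
  have Ys: "corner Ys" "\<And>i. i < k - 1 \<Longrightarrow> earlier (Ys ! i) x"
    "\<And>z. z \<in> E \<Longrightarrow> weak_box Ys z \<Longrightarrow> box Ys z"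
    using assms(2) by (auto simp: node_def x_def)
  have len: "length Ys = k - 1" "length Zs = k - 1" using Ys(1) Zs by (auto simp: corner_def)
  have nth: "Zs ! i = (if i = j then x else Ys ! i)" if "i < k - 1" for i
    using that len Zs by (simp add: nth_list_update)
  have corner: "corner Zs"
    unfolding corner_def
  proof (intro conjI allI impI)
    fix i assume "i < k - 1"
    then show "Zs ! i \<in> insert (dummy k i) E"
      using Ys(1) x nth by (auto simp: corner_def)
  next
    fix i l assume il: "i < k - 1" "l < k - 1" "i \<noteq> l"
    consider "l = j" | "i = j" | "i \<noteq> j" "l \<noteq> j" by blast
    then show "coord_less l (Zs ! i) (Zs ! l)"
    proof cases
      case 1
      then show ?thesis using br[of i] Ys(2)[of i] il by (auto simp: nth coord_less_def)
    next
      case 2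
      then show ?thesis using x(2) il by (auto simp: nth coord_less_def box_def)
    next
      case 3
      then show ?thesis using Ys(1) il by (auto simp: nth corner_def)
    qed
  qed (use len in simp)
  have weak: "box Zs z" if z: "z \<in> E" "weak_box Zs z" for z
  proof -
    have zj: "coord_less j z x" using z(2) j nth[of j] by (auto simp: weak_box_def)
    have xj: "x ! j < Ys ! j ! j" using x(2) j by (simp add: box_def)
    have "weak_box Ys z"
      unfolding weak_box_def
    proof (intro allI impI)
      fix i assume "i < k - 1"
      then show "coord_less i z (Ys ! i)"
        using z(2) nth[of i] zj xj
        by (cases "i = j") (auto simp: weak_box_def coord_less_def)
    qed
    then have b: "box Ys z" using Ys(3) z(1) by blast
    have "\<not> earlier z x"
      using node_empty[OF assms(2) z(1)] \<open>weak_box Ys z\<close> by (auto simp: x_def)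
    then have "z ! j < x ! j" using zj by (simp add: coord_less_def)
    then show ?thesis using b nth by (auto simp: box_def)
  qed
  \<comment> \<open>No image in the parent's box precedes \<open>x\<close>, and the new box excludes
    \<open>x\<close> itself.\<close>
  have xopt: "earlier x (opt Zs)"
    using corner
  proof (cases rule: opt_cases)
    case 1
    then show ?thesis using x E_earlier_dummy by simp
  next
    case (2 y)
    then have "box Ys (opt Zs)" "opt Zs ! j < x ! j"
      using box_child[OF j x(2) len(1)] by (simp_all add: Zs)
    then have "weak_box Ys (opt Zs)" "opt Zs \<noteq> x" using box_imp_weak_box by auto
    then show ?thesis
      using node_empty[OF assms(2) 2(3)] earlier_linear by (auto simp: x_def)
  qed
  then have "earlier (Zs ! i) (opt Zs)" if "i < k - 1" for i
    using that nth Ys(2) by (auto intro: earlier_trans)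
  with corner weak show ?thesis by (simp add: node_def)
qed

lemma node_reachable: "child\<^sup>*\<^sup>* Ys Zs \<Longrightarrow> node Ys \<Longrightarrow> node Zs"
  by (induction rule: rtranclp_induct) (auto intro: node_child)

lemma start_nth: "i < k - 1 \<Longrightarrow> start k ! i = dummy k i"
  by (simp add: start_def)

lemma node_start: "node (start k)"
proof -
  have corner: "corner (start k)"
    unfolding corner_def by (auto simp: start_nth coord_less_def nth_dummy) (auto simp: start_def)
  have "box (start k) z" if "z \<in> E" for z
    using nth_E[OF that] by (auto simp: box_def start_nth nth_dummy)
  moreover have "earlier (start k ! i) (opt (start k))" if "i < k - 1" for i
    using corner
    by (cases rule: opt_cases) (use that dummy_earlier_E dummy_earlier_dummy start_nth in auto)
  ultimately show ?thesis using corner by (simp add: node_def)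
qed

text \<open>Otherwise \<open>Ys ! j\<close> would be an image in the tie-broken box of
  \<open>Ys'\<close> and earlier than \<open>opt Ys'\<close>, against \<open>node_empty\<close>.
  Used in both directions, this determines the replaced entry.\<close>

lemma parent_unique_aux:
  assumes "node Ys" "node Ys'" "opt Ys = opt Ys'" "j < k - 1"
    and eq: "\<And>i. i < k - 1 \<Longrightarrow> i \<noteq> j \<Longrightarrow> Ys ! i = Ys' ! i"
  shows "\<not> coord_less j (Ys ! j) (Ys' ! j)"
proof
  assume less: "coord_less j (Ys ! j) (Ys' ! j)"
  have c: "corner Ys" "corner Ys'" using assms by (auto simp: node_def)
  have "Ys ! j \<noteq> dummy k j"
  proof
    assume dj: "Ys ! j = dummy k j"
    then have "\<infinity> \<le> Ys' ! j ! j"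
      using coord_less_imp_le[OF less] assms(4) by (simp add: nth_dummy)
    then have "Ys' ! j \<notin> E" using nth_E[of "Ys' ! j" j] assms(4) by fastforce
    then have "Ys' ! j = dummy k j"
      using c(2) assms(4) by (auto simp: corner_def)
    then show False using less dj by simp
  qed
  then have "Ys ! j \<in> E" using c(1) assms(4) by (auto simp: corner_def)
  moreover have "weak_box Ys' (Ys ! j)"
    unfolding weak_box_def
  proof (intro allI impI)
    fix i assume "i < k - 1"
    then have "i \<noteq> j \<Longrightarrow> coord_less i (Ys ! j) (Ys ! i)"
      using c(1) assms(4) by (simp add: corner_def)
    with \<open>i < k - 1\<close> show "coord_less i (Ys ! j) (Ys' ! i)"
      using less eq[of i] by (cases "i = j") simp_all
  qed
  moreover have "earlier (Ys ! j) (opt Ys')"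
    using assms by (auto simp: node_def)
  ultimately show False using node_empty[OF assms(2)] by blast
qed

text \<open>
  The image inserted last is the latest entry of the child, and the entry which it replaced is the
  least one, in its coordinate, among the earlier images compatible with the other entries.
\<close>

lemma parent_unique:
  assumes "child Ys Zs" "node Ys" "child Ys' Zs" "node Ys'"
  shows "Ys = Ys'"
proof -
  obtain j where j: "j < k - 1" "Zs = Ys[j := opt Ys]" by (rule childE[OF assms(1,2)]) blast
  obtain j' where j': "j' < k - 1" "Zs = Ys'[j' := opt Ys']" by (rule childE[OF assms(3,4)]) blast
  have len: "length Ys = k - 1" "length Ys' = k - 1"
    using assms by (auto simp: node_def corner_def)
  have nth: "Zs ! i = (if i = j then opt Ys else Ys ! i)" if "i < k - 1" for i
    using that len j by (simp add: nth_list_update)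
  have nth': "Zs ! i = (if i = j' then opt Ys' else Ys' ! i)" if "i < k - 1" for i
    using that len j' by (simp add: nth_list_update)
  have "earlier (Zs ! i) (Zs ! j)" if "i < k - 1" "i \<noteq> j" for i
    using that assms(2) nth[of i] nth[of j] j by (simp add: node_def)
  moreover have "earlier (Zs ! i) (Zs ! j')" if "i < k - 1" "i \<noteq> j'" for i
    using that assms(4) nth'[of i] nth'[of j'] j' by (simp add: node_def)
  \<comment> \<open>Both \<open>j\<close> and \<open>j'\<close> mark the latest entry of
    \<open>Zs\<close>; if they differed, that entry would precede itself.\<close>
  ultimately have "j \<noteq> j' \<Longrightarrow> earlier (Zs ! j) (Zs ! j)"
    using j(1) j'(1) earlier_trans[of "Zs ! j" "Zs ! j'" "Zs ! j"] by simp
  then have [simp]: "j' = j" by auto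
  have opt: "opt Ys = opt Ys'" using nth[of j] nth'[of j] j(1) by simp
  have eq: "Ys ! i = Ys' ! i" if "i < k - 1" "i \<noteq> j" for i
    using nth[of i] nth'[of i] that by simp
  have "\<not> coord_less j (Ys ! j) (Ys' ! j)" "\<not> coord_less j (Ys' ! j) (Ys ! j)"
    using parent_unique_aux[of Ys Ys' j] parent_unique_aux[of Ys' Ys j] assms opt j(1) eq
    by auto
  then have "Ys ! j = Ys' ! j" using coord_less_linear by blast
  then have "Ys ! i = Ys' ! i" if "i < k - 1" for i
    using eq that by (cases "i = j") auto
  then show ?thesis using len by (intro nth_equalityI) auto
qed

section \<open>Termination measure and tree structure of the calls\<close>

definition num_feasible :: "ereal list list \<Rightarrow> nat" where
  "num_feasible Ys = card {z \<in> E. box Ys z}"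

text \<open>The image \<open>opt Ys\<close> leaves the box because it becomes its own bound in
  coordinate \<open>j\<close>. The decrease gives termination and acyclicity of
  \<open>child\<close>.\<close>

lemma num_feasible_child:
  assumes "child Ys Zs" "node Ys"
  shows "num_feasible Zs < num_feasible Ys"
proof -
  obtain j where j: "j < k - 1" "opt Ys \<in> E" "box Ys (opt Ys)" "Zs = Ys[j := opt Ys]"
    by (rule childE[OF assms]) blast
  have "length Ys = k - 1" using assms(2) by (simp add: node_def corner_def)
  from box_child[OF j(1,3) this] j
  have "box Zs z \<Longrightarrow> box Ys z \<and> z ! j < opt Ys ! j" for z by simp
  then have "{z \<in> E. box Zs z} \<subset> {z \<in> E. box Ys z}"
    using j(2,3) by blast
  then show ?thesis unfolding num_feasible_def by (intro psubset_card_mono) auto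
qed

lemma num_feasible_reachable:
  "child\<^sup>*\<^sup>* Ys Zs \<Longrightarrow> node Ys \<Longrightarrow> num_feasible Zs \<le> num_feasible Ys"
proof (induction rule: rtranclp_induct)
  case (step Ws Zs)
  then have "num_feasible Zs < num_feasible Ws"
    using num_feasible_child node_reachable by blast
  then show ?case using step.IH step.prems by linarith
qed simp

lemma child_not_reachable_back: "child Ys Zs \<Longrightarrow> node Ys \<Longrightarrow> \<not> child\<^sup>*\<^sup>* Zs Ys"
  using num_feasible_child[of Ys Zs] num_feasible_reachable[of Zs Ys] node_child[of Ys Zs]
  by auto

text \<open>As parents are unique, walking back from \<open>Zs\<close> retraces a single path, on
  which both ancestors lie.\<close>

lemma ancestors_linear:
  assumes "child\<^sup>*\<^sup>* Ys Zs" "child\<^sup>*\<^sup>* Ys' Zs" "node Ys" "node Ys'"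
  shows "child\<^sup>*\<^sup>* Ys Ys' \<or> child\<^sup>*\<^sup>* Ys' Ys"
  using assms
proof (induction rule: rtranclp_induct)
  case (step Ws Zs)
  from step.prems(1) show ?case
  proof (cases rule: rtranclp.cases)
    case rtrancl_refl
    have "child\<^sup>*\<^sup>* Ys Zs"
      using step.hyps by (rule rtranclp.rtrancl_into_rtrancl)
    then show ?thesis using rtrancl_refl by simp
  next
    case (rtrancl_into_rtrancl Ws')
    moreover have "node Ws" "node Ws'"
      using node_reachable step.hyps(1) step.prems rtrancl_into_rtrancl(1) by auto
    ultimately have "Ws' = Ws" using parent_unique step.hyps(2) by blast
    then show ?thesis using step.IH step.prems rtrancl_into_rtrancl(1) by simp
  qed
qed blast

text \<open>The last step of a path between siblings would start at their common parent, which would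
  then be reachable from its own child.\<close>

lemma siblings_unrelated:
  assumes "node Ys" "child Ys Zs" "child Ys Zs'" "Zs \<noteq> Zs'"
  shows "\<not> child\<^sup>*\<^sup>* Zs Zs'"
proof
  assume "child\<^sup>*\<^sup>* Zs Zs'"
  then show False
  proof (cases rule: rtranclp.cases)
    case rtrancl_refl
    then show ?thesis using assms(4) by simp
  next
    case (rtrancl_into_rtrancl Ws)
    then have "node Ws" using node_reachable node_child assms(1,2) by blast
    then have "Ws = Ys" using parent_unique[OF rtrancl_into_rtrancl(2) _ assms(3,1)] by blast
    then show ?thesis using child_not_reachable_back[OF assms(2,1)] rtrancl_into_rtrancl by simp
  qed
qed

definition subtree :: "ereal list list \<Rightarrow> ereal list list set" where
  "subtree Ys = {Zs. child\<^sup>*\<^sup>* Ys Zs}"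

lemma subtree_unfold: "subtree Ys = insert Ys (\<Union>Zs\<in>{Zs. child Ys Zs}. subtree Zs)"
proof (intro set_eqI iffI)
  fix Zs assume "Zs \<in> subtree Ys"
  then have "child\<^sup>*\<^sup>* Ys Zs" by (simp add: subtree_def)
  then show "Zs \<in> insert Ys (\<Union>Zs\<in>{Zs. child Ys Zs}. subtree Zs)"
    by (cases rule: converse_rtranclpE) (auto simp: subtree_def)
qed (auto simp: subtree_def intro: converse_rtranclp_into_rtranclp)

lemma subtree_siblings_disjoint:
  assumes "node Ys" "child Ys Zs" "child Ys Zs'" "Zs \<noteq> Zs'"
  shows "subtree Zs \<inter> subtree Zs' = {}"
proof (rule ccontr)
  assume "subtree Zs \<inter> subtree Zs' \<noteq> {}"
  then obtain Ws where "child\<^sup>*\<^sup>* Zs Ws" "child\<^sup>*\<^sup>* Zs' Ws" by (auto simp: subtree_def)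
  then have "child\<^sup>*\<^sup>* Zs Zs' \<or> child\<^sup>*\<^sup>* Zs' Zs"
    using ancestors_linear assms node_child by blast
  then show False
    using siblings_unrelated[OF assms] siblings_unrelated[OF assms(1,3,2)] assms(4) by auto
qed

definition found :: "ereal list list \<Rightarrow> real list set" where
  "found Ys = {y. solve (eps k Ys) = Some y \<and> keep k Ys (map ereal y)}"

text \<open>The recursion counts calls, whereas \<open>subtree\<close> is a set of tuples. The
  numbers agree because sibling subtrees are disjoint and no node occurs below itself.\<close>

lemma explore_node:
  assumes "node Ys"
  shows "explore_dom (k, solve, Ys) \<and> finite (subtree Ys) \<and>
    snd (explore k solve Ys) = card (subtree Ys) \<and>
    fst (explore k solve Ys) = (\<Union>Zs\<in>subtree Ys. found Zs)"
  using assms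
proof (induction "num_feasible Ys" arbitrary: Ys rule: less_induct)
  case less
  have IH: "explore_dom (k, solve, Zs) \<and> finite (subtree Zs) \<and>
      snd (explore k solve Zs) = card (subtree Zs) \<and>
      fst (explore k solve Zs) = (\<Union>Ws\<in>subtree Zs. found Ws)" if "child Ys Zs" for Zs
    using less.hyps[of Zs] num_feasible_child node_child that less.prems by blast
  have dom: "explore_dom (k, solve, Ys)"
    by (rule explore.domintros) (use IH in \<open>auto simp: child_def\<close>)
  show ?case
  proof (cases "solve (eps k Ys)")
    case None
    then have "{Zs. child Ys Zs} = {}" by (simp add: child_def)
    then have "subtree Ys = {Ys}" using subtree_unfold[of Ys] by simp
    then show ?thesis using dom None by (simp add: explore.psimps found_def)
  next
    case (Some y)
    define B where "B = branches k Ys (map ereal y)"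
    define c where "c j = Ys[j := map ereal y]" for j
    have children: "{Zs. child Ys Zs} = c ` B"
      using Some by (auto simp: child_def B_def c_def)
    have finB: "finite B" by (rule finite_subset[of _ "{..<k}"]) (auto simp: B_def branches_def)
    have corner: "corner Ys" using less.prems by (simp add: node_def)
    have box: "box Ys (map ereal y)" by (rule solve_Some[OF corner Some])
    \<comment> \<open>Equal children of distinct branches would make the new image an entry
      \<open>Ys ! i\<close>, but it lies strictly below that entry in coordinate
      \<open>i\<close>.\<close>
    have inj: "inj_on c B"
    proof (rule inj_onI, rule ccontr)
      fix i j assume ij: "i \<in> B" "j \<in> B" "c i = c j" "i \<noteq> j"
      then have "i < k - 1" "length Ys = k - 1"
        using corner by (auto simp: B_def branches_def corner_def)
      moreover from this have "map ereal y = Ys ! i"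
        using ij(3,4) by (metis c_def nth_list_update_eq nth_list_update_neq)
      ultimately show False using box by (auto simp: box_def)
    qed
    have sub: "subtree Ys = insert Ys (\<Union>j\<in>B. subtree (c j))"
      using subtree_unfold[of Ys] children by simp
    have child: "child Ys (c j)" if "j \<in> B" for j using children that by blast
    have notin: "Ys \<notin> (\<Union>j\<in>B. subtree (c j))"
      using child_not_reachable_back child less.prems by (auto simp: subtree_def)
    have fins: "finite (\<Union>j\<in>B. subtree (c j))" using finB IH child by blast
    have "card (\<Union>j\<in>B. subtree (c j)) = (\<Sum>j\<in>B. card (subtree (c j)))"
    proof (rule card_UN_disjoint)
      show "\<forall>i\<in>B. \<forall>j\<in>B. i \<noteq> j \<longrightarrow> subtree (c i) \<inter> subtree (c j) = {}"
        using subtree_siblings_disjoint[OF less.prems] child inj by (meson inj_onD)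
    qed (use finB IH child in auto)
    then have "card (subtree Ys) = 1 + (\<Sum>j\<in>B. snd (explore k solve (c j)))"
      unfolding sub using notin fins IH child by simp
    moreover have "(\<Union>Zs\<in>subtree Ys. found Zs)
        = found Ys \<union> (\<Union>j\<in>B. fst (explore k solve (c j)))"
      unfolding sub using IH child by auto
    moreover have "found Ys = (if keep k Ys (map ereal y) then {y} else {})"
      using Some by (auto simp: found_def)
    moreover have "finite (subtree Ys)" unfolding sub using fins by simp
    ultimately show ?thesis
      using dom by (simp add: explore.psimps Some B_def c_def)
  qed
qed

section \<open>Every local upper bound is reached\<close>

text \<open>Local upper bounds for the images preceding \<open>t\<close>, described without solver
  or tree so that reachability can be proved by induction on time.\<close>

definition bound_at :: "ereal list \<Rightarrow> ereal list list \<Rightarrow> bool" where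
  "bound_at t V \<longleftrightarrow> corner V \<and> (\<forall>i<k - 1. earlier (V ! i) t) \<and>
     (\<forall>z\<in>E. earlier z t \<longrightarrow> \<not> weak_box V z)"

text \<open>
  Undoing the insertion of the latest image of \<open>V\<close> gives a local upper bound at an earlier
  time, which is the parent of \<open>V\<close> in the search tree.
\<close>

lemma bound_at_parent:
  assumes V: "bound_at t V" and j: "j < k - 1" "V ! j \<in> E"
    and latest: "\<And>i. i < k - 1 \<Longrightarrow> i \<noteq> j \<Longrightarrow> earlier (V ! i) (V ! j)"
  obtains W where "bound_at (V ! j) W" "weak_box W (V ! j)" "V = W[j := V ! j]"
    "\<And>i. i < k - 1 \<Longrightarrow> i \<noteq> j \<Longrightarrow> W ! i = V ! i"
proof -
  define x where "x = V ! j"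
  \<comment> \<open>Candidates for the entry that \<open>x\<close> replaced; the dummy keeps the set
    nonempty.\<close>
  define Q where "Q = insert (dummy k j)
    {z \<in> E. earlier z x \<and> (\<forall>i<k - 1. i \<noteq> j \<longrightarrow> coord_less i z (V ! i))}"
  have "finite Q" "Q \<noteq> {}" by (simp_all add: Q_def)
  then obtain p where p: "p \<in> Q" and pmin: "\<And>z. z \<in> Q \<Longrightarrow> \<not> coord_less j z p"
    by (rule ex_coord_least[where i = j]) blast
  define W where "W = V[j := p]"
  have corner: "corner V" using V by (simp add: bound_at_def)
  then have len: "length V = k - 1" by (simp add: corner_def)
  have nth: "W ! i = (if i = j then p else V ! i)" if "i < k - 1" for i
    using that len by (simp add: W_def nth_list_update)
  have cross: "coord_less l (V ! i) (V ! l)" if "i < k - 1" "l < k - 1" "i \<noteq> l" for i l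
    using corner that by (auto simp: corner_def)
  have p_slab: "coord_less i p (V ! i)" if "i < k - 1" "i \<noteq> j" for i
    using p that corner_bound_gt[OF corner that(1)]
    by (auto simp: Q_def coord_less_def nth_dummy)
  have p_earlier: "earlier p x"
    using p dummy_earlier_E[OF j] by (auto simp: Q_def x_def)
  \<comment> \<open>Otherwise \<open>p\<close> would be an image earlier than \<open>t\<close> in
    the tie-broken box of \<open>V\<close>.\<close>
  have xp: "coord_less j x p"
  proof (rule ccontr)
    assume "\<not> coord_less j x p"
    then have "coord_less j p x"
      using coord_less_linear[of j x p] p_earlier by auto
    then have weak: "weak_box V p"
      unfolding weak_box_def x_def using p_slab by metis
    have "p \<noteq> dummy k j"
      using coord_less_imp_le[OF \<open>coord_less j p x\<close>] nth_E[OF j(2), of j] j(1)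
      by (auto simp: nth_dummy x_def)
    then have "p \<in> E" using p by (auto simp: Q_def)
    moreover have "earlier p t"
      using p_earlier V j(1) earlier_trans[of p x t] by (simp add: bound_at_def x_def)
    ultimately show False using weak V by (auto simp: bound_at_def)
  qed
  have cornerW: "corner W"
    unfolding corner_def
  proof (intro conjI allI impI)
    fix i assume "i < k - 1"
    then show "W ! i \<in> insert (dummy k i) E"
      using corner p nth by (auto simp: corner_def Q_def)
  next
    fix i l assume il: "i < k - 1" "l < k - 1" "i \<noteq> l"
    consider "l = j" | "i = j" | "i \<noteq> j" "l \<noteq> j" by blast
    then show "coord_less l (W ! i) (W ! l)"
    proof cases
      case 1
      then have "coord_less j (V ! i) x" using cross[of i j] il by (simp add: x_def)
      then have "coord_less j (V ! i) p" using xp by (rule coord_less_trans)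
      then show ?thesis using 1 il j(1) by (simp add: nth)
    next
      case 2
      then show ?thesis using p_slab il by (simp add: nth)
    next
      case 3
      then show ?thesis using cross il by (simp add: nth)
    qed
  qed (use len in \<open>simp add: W_def\<close>)
  moreover have "earlier (W ! i) x" if "i < k - 1" for i
    using that nth p_earlier latest by (simp add: x_def)
  moreover have "\<not> weak_box W z" if z: "z \<in> E" "earlier z x" for z
  proof
    assume w: "weak_box W z"
    then have "z \<in> Q" using z nth by (auto simp: weak_box_def Q_def)
    moreover have "coord_less j z p" using w nth[of j] j by (auto simp: weak_box_def)
    ultimately show False using pmin by blast
  qed
  ultimately have "bound_at x W" by (simp add: bound_at_def)
  moreover have "weak_box W x"
    unfolding weak_box_def
  proof (intro allI impI)
    fix i assume "i < k - 1"
    then show "coord_less i x (W ! i)"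
      using xp cross[of j i] j(1) by (cases "i = j") (simp_all add: nth x_def)
  qed
  moreover have "V = W[j := x]" by (simp add: W_def x_def)
  moreover have "W ! i = V ! i" if "i < k - 1" "i \<noteq> j" for i
    using nth that by simp
  ultimately show thesis
    by (rule that[of W, folded x_def])
qed

lemma bound_at_opt:
  assumes "node V" "bound_at t V" "t \<in> E" "weak_box V t"
  shows "opt V = t"
proof (rule opt_eqI)
  show "corner V" "box V t" using assms by (auto simp: node_def)
  show "\<not> earlier z t" if "z \<in> E" "box V z" for z
    using that assms(2) box_imp_weak_box by (auto simp: bound_at_def)
qed fact

text \<open>Removing the latest image \<open>V ! j\<close> gives a bound \<open>W\<close> at time
  \<open>V ! j\<close>, reachable by induction. At \<open>W\<close> the solver returns
  \<open>V ! j\<close>, and branch \<open>j\<close> leads to \<open>V\<close>.\<close>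

lemma reachable_if_bound_at:
  assumes "t \<in> E" "bound_at t V"
  shows "child\<^sup>*\<^sup>* (start k) V"
  using assms
proof (induction "card {z \<in> E. earlier z t}" arbitrary: t V rule: less_induct)
  case less
  have corner: "corner V" using less.prems by (simp add: bound_at_def)
  then have len: "length V = k - 1" by (simp add: corner_def)
  define I where "I = {i. i < k - 1 \<and> V ! i \<in> E}"
  show ?case
  proof (cases "I = {}")
    case True
    then have "V = start k"
      using corner by (intro nth_equalityI) (auto simp: corner_def I_def start_def)
    then show ?thesis by simp
  next
    case False
    have "\<exists>m\<in>(!) V ` I. \<forall>x\<in>(!) V ` I. x \<noteq> m \<longrightarrow> \<not> earlier m x"
      by (rule Finite_Set.bex_max_element)
        (use False in \<open>auto simp: I_def intro!: asymp_onI transp_onI dest: earlier_trans\<close>)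
    then obtain j where j: "j < k - 1" "V ! j \<in> E"
      and jmax: "\<And>i. i \<in> I \<Longrightarrow> V ! i \<noteq> V ! j \<Longrightarrow> \<not> earlier (V ! j) (V ! i)"
      by (auto simp: I_def)
    have latest: "earlier (V ! i) (V ! j)" if i: "i < k - 1" "i \<noteq> j" for i
    proof (cases "i \<in> I")
      case True
      have "coord_less j (V ! i) (V ! j)" using corner i j by (auto simp: corner_def)
      then have "V ! i \<noteq> V ! j" by auto
      then show ?thesis using jmax[OF True] earlier_linear by blast
    next
      case False
      then have "V ! i = dummy k i" using corner i by (auto simp: corner_def I_def)
      then show ?thesis using dummy_earlier_E i(1) j(2) by simp
    qed
    obtain W where W: "bound_at (V ! j) W" "weak_box W (V ! j)" "V = W[j := V ! j]"
      and Wi: "\<And>i. i < k - 1 \<Longrightarrow> i \<noteq> j \<Longrightarrow> W ! i = V ! i"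
      using bound_at_parent[OF less.prems(2) j latest] by blast
    have "earlier (V ! j) t" using less.prems(2) j by (simp add: bound_at_def)
    then have "{z \<in> E. earlier z (V ! j)} \<subseteq> {z \<in> E. earlier z t}"
      "V ! j \<in> {z \<in> E. earlier z t} - {z \<in> E. earlier z (V ! j)}"
      using j(2) earlier_trans by auto
    then have "{z \<in> E. earlier z (V ! j)} \<subset> {z \<in> E. earlier z t}" by blast
    then have "card {z \<in> E. earlier z (V ! j)} < card {z \<in> E. earlier z t}"
      by (intro psubset_card_mono) auto
    then have reach: "child\<^sup>*\<^sup>* (start k) W"
      using less.hyps j(2) W(1) by blast
    then have node: "node W" using node_reachable node_start by blast
    then have opt: "opt W = V ! j" using bound_at_opt W j by blast
    moreover have "corner W" using node by (simp add: node_def)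
    ultimately obtain y where y: "solve (eps k W) = Some y" "V ! j = map ereal y"
      using solve_of_opt j(2) by metis
    \<comment> \<open>Off \<open>j\<close> the tuples agree, so the test in step 3 follows from the
      corner condition of \<open>V\<close> in coordinate \<open>j\<close>.\<close>
    have "W ! i ! j \<le> V ! j ! j" if "i < k - 1" "i \<noteq> j" for i
      using corner that j(1) Wi coord_less_imp_le[of j "V ! i" "V ! j"]
      by (simp add: corner_def)
    then have "j \<in> branches k W (map ereal y)"
      using j(1) y(2) by (auto simp: branches_def)
    then have "child W V" using y W(3) unfolding child_def by metis
    then show ?thesis using reach by simp
  qed
qed

text \<open>
  An image \<open>z\<close> found before \<open>y\<close> exceeds \<open>y\<close> in some coordinate; grouping such images by the
  last coordinate \<open>i\<close> of this kind, the entry with index \<open>i\<close> is chosen in the \<open>i\<close>-th group.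
\<close>

lemma ex_kept_bound:
  assumes y: "y \<in> E"
  obtains V where "bound_at y V" "weak_box V y" "keep k V y"
proof -
  \<comment> \<open>\<open>T i\<close> holds the points exceeding \<open>y\<close> in coordinate
    \<open>i\<close> that would pass the test in step 2 as entry \<open>i\<close>.\<close>
  define T where "T i = {z \<in> insert (dummy k i) E. y ! i < z ! i \<and>
    vec_dom (drop (Suc i) z) (drop (Suc i) y)}" for i
  have ly: "length y = k" using length_E y by simp
  have finT: "finite (T i)" for i by (simp add: T_def)
  have lenT: "length z = k" if "z \<in> T i" for z i using that length_E by (auto simp: T_def)
  have dT: "dummy k i \<in> T i" if "i < k - 1" for i
  proof -
    have "vec_dom (drop (Suc i) (dummy k i)) (drop (Suc i) y)"
      using that nth_E[OF y] drop_dom_iff[OF length_dummy ly, of i i]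
      by (auto simp: nth_dummy intro!: exI[of _ "k - 1"])
    then show ?thesis using that nth_E[OF y, of i] by (simp add: T_def nth_dummy)
  qed
  \<comment> \<open>Greedy choice: entry \<open>i\<close> is least in coordinate \<open>i\<close>
    among the points of \<open>T i\<close> lying below each earlier entry in that entry's
    coordinate.\<close>
  have "\<exists>V. length V = n \<and> (\<forall>i<n. V ! i \<in> T i \<and> (\<forall>l<i. coord_less l (V ! i) (V ! l)) \<and>
      (\<forall>z\<in>T i. (\<forall>l<i. coord_less l z (V ! l)) \<longrightarrow> \<not> coord_less i z (V ! i)))"
    (is "\<exists>V. ?P n V") if "n \<le> k - 1" for n
    using that
  proof (induction n)
    case (Suc n)
    then obtain V where V: "?P n V" by auto
    let ?A = "{z \<in> T n. \<forall>l<n. coord_less l z (V ! l)}"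
    have "coord_less l (dummy k n) (V ! l)" if "l < n" for l
    proof -
      have "y ! l < V ! l ! l" using V that by (auto simp: T_def)
      then show ?thesis using that Suc.prems by (auto simp: coord_less_def nth_dummy)
    qed
    then have "dummy k n \<in> ?A" using dT Suc.prems by auto
    then obtain m where m: "m \<in> ?A" "\<And>z. z \<in> ?A \<Longrightarrow> \<not> coord_less n z m"
      using ex_coord_least[of ?A n] finT[of n] by auto
    have "?P (Suc n) (V @ [m])"
      using V m by (auto simp: nth_append less_Suc_eq)
    then show ?case by blast
  qed auto
  then obtain V where len: "length V = k - 1" and VT: "\<And>i. i < k - 1 \<Longrightarrow> V ! i \<in> T i"
    and down: "\<And>i l. i < k - 1 \<Longrightarrow> l < i \<Longrightarrow> coord_less l (V ! i) (V ! l)"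
    and least: "\<And>i z. i < k - 1 \<Longrightarrow> z \<in> T i \<Longrightarrow> (\<And>l. l < i \<Longrightarrow> coord_less l z (V ! l)) \<Longrightarrow>
      \<not> coord_less i z (V ! i)"
    by (metis order_refl)
  have lenV: "length (V ! i) = k" if "i < k - 1" for i using VT lenT that by blast
  have dom: "vec_dom (drop (Suc i) (V ! i)) (drop (Suc i) y)" if "i < k - 1" for i
    using VT[OF that] by (simp add: T_def)
  have box: "box V y" using VT by (auto simp: box_def T_def)
  have "corner V"
    unfolding corner_def
  proof (intro conjI allI impI)
    fix i assume "i < k - 1"
    then show "V ! i \<in> insert (dummy k i) E" using VT by (auto simp: T_def)
  next
    fix i l assume il: "i < k - 1" "l < k - 1" "i \<noteq> l"
    show "coord_less l (V ! i) (V ! l)"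
    proof (cases "l < i")
      case True
      then show ?thesis using down il by blast
    next
      case False
      \<comment> \<open>Behind \<open>i\<close> the test in step 2 bounds the entry by
        \<open>y\<close>, which is strictly inside the box.\<close>
      then have "V ! i ! l \<le> y ! l"
        using dom[OF il(1)] drop_dom_iff[OF lenV[OF il(1)] ly, of i] il by auto
      also have "y ! l < V ! l ! l" using box il by (simp add: box_def)
      finally show ?thesis by (simp add: coord_less_def)
    qed
  qed (rule len)
  moreover have "earlier (V ! i) y" if "i < k - 1" for i
    using drop_dom_imp_earlier[OF lenV[OF that] ly _ dom[OF that]] that by simp
  moreover have "\<not> weak_box V z" if z: "z \<in> E" "earlier z y" for z
  proof
    assume weak: "weak_box V z"
    have lz: "length z = k" using z length_E by simp
    \<comment> \<open>\<open>J\<close> is nonempty since \<open>z\<close> does not dominate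
      \<open>y\<close>. Its maximum \<open>i\<close> will put \<open>z\<close> into
      \<open>T i\<close>, against the minimality of \<open>V ! i\<close>.\<close>
    define J where "J = {i. i < k \<and> y ! i < z ! i}"
    have "J \<noteq> {}"
    proof
      assume "J = {}"
      then have le: "\<forall>i<k. z ! i \<le> y ! i" unfolding J_def by (metis (lifting) empty_Collect_eq not_less)
      obtain y' z' where y': "y' \<in> N" "y = map ereal y'" and z': "z' \<in> N" "z = map ereal z'"
        using y z by (auto simp: E_def)
      have "vec_dom z' y'"
        using le y' z' z(2) ly lz by (auto simp: vec_dom_def list_all2_conv_all_nth)
      then show False using antichain y' z' by blast
    qed
    define i where "i = Max J"
    have "finite J" by (simp add: J_def)
    then have i: "i < k" "y ! i < z ! i"
      using Max_in[OF _ \<open>J \<noteq> {}\<close>] by (auto simp: i_def J_def)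
    have above: "z ! l \<le> y ! l" if "i < l" "l < k" for l
      using Max_ge[OF \<open>finite J\<close>, of l] that by (force simp: i_def J_def not_less[symmetric])
    obtain m where m: "m < k" "z ! m < y ! m" "\<forall>l. m < l \<and> l < k \<longrightarrow> z ! l = y ! l"
      using z(2) earlier_iff[OF lz ly] by auto
    \<comment> \<open>At \<open>m\<close> the image \<open>z\<close> is below \<open>y\<close>, and
      behind \<open>m\<close> they agree. So \<open>i\<close> is not the last coordinate, and
      dominance behind \<open>i\<close> is strict.\<close>
    have "i < m"
      using m i by (metis linorder_neqE_nat order_less_asym order_less_irrefl)
    then have "vec_dom (drop (Suc i) z) (drop (Suc i) y)"
      using drop_dom_iff[OF lz ly i(1)] above m by auto
    then have "z \<in> T i" using z i by (simp add: T_def)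
    moreover have "i < k - 1" using \<open>i < m\<close> m(1) by simp
    ultimately show False using weak least[of i z] by (auto simp: weak_box_def)
  qed
  ultimately have "bound_at y V" by (simp add: bound_at_def)
  moreover have "keep k V y" using dom by (simp add: keep_def)
  ultimately show thesis using that box box_imp_weak_box by blast
qed

section \<open>Correctness and number of calls\<close>

lemma terminates: "pea_terminates k solve"
  using explore_node[OF node_start] by (simp add: pea_terminates_def)

text \<open>Soundness comes from the solver. For completeness, the bound from
  \<open>ex_kept_bound\<close> is reached, and there the solver returns \<open>y\<close>, which
  passes the test.\<close>

lemma output_eq: "pea_output k solve = N"
proof
  have out: "pea_output k solve = (\<Union>Zs\<in>subtree (start k). found Zs)"
    using explore_node[OF node_start] by (simp add: pea_output_def)
  show "pea_output k solve \<subseteq> N"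
  proof
    fix y assume "y \<in> pea_output k solve"
    then obtain Zs where Zs: "child\<^sup>*\<^sup>* (start k) Zs" "solve (eps k Zs) = Some y"
      by (auto simp: out subtree_def found_def)
    then have "corner Zs" using node_reachable node_start by (auto simp: node_def)
    then show "y \<in> N" using solve_Some(1) Zs(2) by blast
  qed
  show "N \<subseteq> pea_output k solve"
  proof
    fix y assume y: "y \<in> N"
    then have yE: "map ereal y \<in> E" by (simp add: E_def)
    obtain V where V: "bound_at (map ereal y) V" "weak_box V (map ereal y)"
      "keep k V (map ereal y)"
      by (rule ex_kept_bound[OF yE])
    have reach: "child\<^sup>*\<^sup>* (start k) V" using reachable_if_bound_at[OF yE V(1)] .
    then have node: "node V" using node_reachable node_start by blast
    then have opt: "opt V = map ereal y" using bound_at_opt[OF _ V(1) yE V(2)] by blast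
    moreover have "corner V" using node by (simp add: node_def)
    ultimately obtain y' where "solve (eps k V) = Some y'" "map ereal y = map ereal y'"
      using yE solve_of_opt by metis
    then have "y \<in> found V"
      using V(3) by (auto simp: found_def inj_map_eq_map inj_def)
    then show "y \<in> pea_output k solve"
      using reach by (auto simp: out subtree_def)
  qed
qed

text \<open>\<open>opt Ys\<close> supplies the last coordinate, ordered by \<open>earlier\<close>.
  Images earlier than it are outside by \<open>node_empty\<close>, all others by the last
  coordinate.\<close>

lemma local_upper_bound_node:
  assumes "node Ys"
  shows "local_upper_bound (\<lambda>i. if i < k - 1 then coord_less i else earlier) k E (dummy k)
    (Ys @ [opt Ys])"
proof -
  let ?L = "\<lambda>i. if i < k - 1 then coord_less i else (earlier :: ereal list \<Rightarrow> _)"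
  let ?p = "Ys @ [opt Ys]"
  have corner: "corner Ys" using assms by (simp add: node_def)
  then have len: "length Ys = k - 1" by (simp add: corner_def)
  have nth: "?p ! i = (if i < k - 1 then Ys ! i else opt Ys)" if "i < k" for i
    using that len by (auto simp: nth_append)
  have opt: "opt Ys \<in> insert (dummy k (k - 1)) E"
    by (cases rule: opt_cases[OF corner]) auto
  have opt_less: "coord_less l (opt Ys) (Ys ! l)" if "l < k - 1" for l
  proof (cases rule: opt_cases[OF corner])
    case 1
    then show ?thesis
      using corner_bound_gt[OF corner that] that by (simp add: coord_less_def nth_dummy)
  next
    case (2 y)
    then show ?thesis using that by (simp add: coord_less_def box_def)
  qed
  have "?p ! i \<in> insert (dummy k i) E" if "i < k" for i
  proof (cases "i < k - 1")
    case True
    then show ?thesis using nth[OF that] corner by (auto simp: corner_def)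
  next
    case False
    then have "i = k - 1" using that by simp
    then show ?thesis using nth[OF that] opt by simp
  qed
  moreover have "?L l (?p ! i) (?p ! l)" if "i < k" "l < k" "i \<noteq> l" for i l
  proof (cases "l < k - 1")
    case True
    then show ?thesis
      using nth[OF that(1)] nth[OF that(2)] corner opt_less that(3) by (auto simp: corner_def)
  next
    case False
    then have "i < k - 1" using that by auto
    then show ?thesis
      using nth[OF that(1)] nth[OF that(2)] False assms by (simp add: node_def)
  qed
  moreover have "\<exists>l<k. \<not> ?L l z (?p ! l)" if z: "z \<in> E" for z
  proof (cases "earlier z (opt Ys)")
    case True
    then obtain l where "l < k - 1" "\<not> coord_less l z (Ys ! l)"
      using node_empty[OF assms z] by (auto simp: weak_box_def)
    then show ?thesis using nth[of l] by (intro exI[of _ l]) auto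
  next
    case False
    then show ?thesis using nth[of "k - 1"] k2 by (intro exI[of _ "k - 1"]) auto
  qed
  ultimately show ?thesis
    using len k2 unfolding local_upper_bound_def by auto
qed

text \<open>Dropping the last point recovers the call, so distinct nodes give distinct local upper
  bounds.\<close>

lemma calls_le: "pea_calls k solve \<le> 2 ^ k * (card N + 1) ^ (k div 2)"
proof -
  let ?L = "\<lambda>i. if i < k - 1 then coord_less i else (earlier :: ereal list \<Rightarrow> _)"
  let ?V = "(\<lambda>Ys. Ys @ [opt Ys]) ` subtree (start k)"
  have "card ?V \<le> 2 ^ k * (card E + 1) ^ (k div 2)"
  proof (rule card_local_upper_bounds[where L = ?L and hi = "dummy k"])
    fix l
    show "transp (?L l)" by (auto intro!: transpI intro: coord_less_trans earlier_trans)
    show "totalp (?L l)"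
    proof (rule totalpI)
      fix a b :: "ereal list" assume "a \<noteq> b"
      then show "?L l a b \<or> ?L l b a"
        using coord_less_linear[of l a b] earlier_linear[of a b] by simp
    qed
    show "irreflp (?L l)" by (auto intro!: irreflpI)
  next
    fix i z assume i: "i < k" and z: "z \<in> insert (dummy k i) E"
    show "\<not> ?L i (dummy k i) z"
    proof (cases "z \<in> E")
      case True
      then have "\<not> coord_less i (dummy k i) z"
        using nth_E[of z i] i by (auto simp: coord_less_def nth_dummy)
      moreover have "i = k - 1 \<Longrightarrow> \<not> earlier (dummy k i) z"
        using E_earlier_dummy[OF True] earlier_trans earlier_irrefl by blast
      moreover have "i < k - 1 \<or> i = k - 1" using i by linarith
      ultimately show ?thesis by auto
    next
      case False
      then show ?thesis using z by auto
    qed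
  next
    fix p assume "p \<in> ?V"
    then show "local_upper_bound ?L k E (dummy k) p"
      using local_upper_bound_node node_reachable node_start by (auto simp: subtree_def)
  qed simp
  moreover have "card ?V = card (subtree (start k))"
    by (intro card_image inj_onI) simp
  moreover have "pea_calls k solve = card (subtree (start k))"
    using explore_node[OF node_start] by (simp add: pea_calls_def)
  ultimately show ?thesis by (simp add: card_E)
qed

end

section \<open>Transfer to the optimization problem\<close>

lemma pea_run_moip:
  assumes "k \<ge> 2" "moip k n X f" "is_solver k (nondominated (f ` X)) solve"
  shows "pea_run k (nondominated (f ` X)) solve"
  using assms by unfold_locales (auto simp: moip_def nondominated_def)

theorem theorem28:
  fixes k :: nat
  assumes "k \<ge> 2"
  shows "(\<forall>n X f solve.
            moip k n X f \<and> is_solver k (nondominated (f ` X)) solve \<longrightarrow>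
            pea_terminates k solve \<and> pea_output k solve = nondominated (f ` X))
       \<and> (\<exists>C::real. \<forall>n X f solve.
            moip k n X f \<and> is_solver k (nondominated (f ` X)) solve
            \<and> nondominated (f ` X) \<noteq> {} \<longrightarrow>
            real (pea_calls k solve) \<le> C * real (card (nondominated (f ` X))) ^ (k div 2))"
proof (intro conjI allI impI)
  fix n X f solve
  assume "moip k n X f \<and> is_solver k (nondominated (f ` X)) solve"
  then interpret pea_run k "nondominated (f ` X)" solve
    using pea_run_moip[OF assms] by blast
  show "pea_terminates k solve" "pea_output k solve = nondominated (f ` X)"
    by (rule terminates) (rule output_eq)
next
  show "\<exists>C::real. \<forall>n X f solve.
            moip k n X f \<and> is_solver k (nondominated (f ` X)) solve
            \<and> nondominated (f ` X) \<noteq> {} \<longrightarrow>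
            real (pea_calls k solve) \<le> C * real (card (nondominated (f ` X))) ^ (k div 2)"
  proof (intro exI allI impI)
    fix n X f solve
    assume *: "moip k n X f \<and> is_solver k (nondominated (f ` X)) solve
            \<and> nondominated (f ` X) \<noteq> {}"
    then interpret pea_run k "nondominated (f ` X)" solve
      using pea_run_moip[OF assms] by blast
    let ?n = "card (nondominated (f ` X))"
    \<comment> \<open>Nonemptiness gives \<open>?n + 1 \<le> 2 * ?n\<close>, absorbing the summand
      for the dummies; the constant \<open>2 ^ k * 2 ^ (k div 2)\<close> depends on \<open>k\<close>
      alone.\<close>
    have "?n \<ge> 1" using * fin by (simp add: Suc_leI card_gt_0_iff)
    then have "(?n + 1) ^ (k div 2) \<le> (2 * ?n) ^ (k div 2)"
      by (intro power_mono) auto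
    then have "2 ^ k * (?n + 1) ^ (k div 2) \<le> 2 ^ k * (2 * ?n) ^ (k div 2)"
      by (rule mult_left_mono) simp
    with calls_le have "pea_calls k solve \<le> 2 ^ k * (2 * ?n) ^ (k div 2)"
      by (rule order_trans)
    then have "real (pea_calls k solve) \<le> real (2 ^ k * (2 * ?n) ^ (k div 2))"
      by (rule of_nat_mono)
    then show "real (pea_calls k solve) \<le> (2 ^ k * 2 ^ (k div 2)) * real ?n ^ (k div 2)"
      by (simp add: power_mult_distrib)
  qed
qed

end
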